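(* Let $P$ be a finite poset and $m$ a nonnegative integer. Let $\Theta:\mathcal{E}_m(P)\to\mathbb{R}^P$ be the map defined by $$(\Theta(h))(v)=\begin{cases} h(v) & \text{if } v \text{ is minimal in } P \text{ or } h(v)\ge 0,\\ h(v)+2\max\{|h(w)| : w\lessdot v\} & \text{if } v \text{ is not minimal in } P \text{ and } h(v)<0.\end{cases}$$ Then $\Theta$ gives a bijection from $\mathcal{E}_m(P)$ to $m\mathcal{O}^{(e)}(P)\cap\mathbb{Z}^P$.
   Context: $w\lessdot v$ means that $v$ covers $w$ in $P$. $\mathbb{R}^P$ (resp. $\mathbb{Z}^P$) is the set of real-valued (resp. integer-valued) functions on $P$. A left enriched $P$-partition is a map $h:P\to\mathbb{Z}$ such that (i) if $v\le w$, then $|h(v)|\le|h(w)|$; (ii) if $v<w$ and $|h(v)|=|h(w)|$, then $h(w)\ge 0$. $\mathcal{E}_m(P)$ is the set of left enriched $P$-partitions $h$ with $|h(v)|\le m$ for all $v\in P$. An order filter of $P$ is a subset $F\subset P$ such that $v\in F$ and $v<w$ imply $w\in F$; $\operatorname{supp}(f)=\{v\in P:f(v)\ne0\}$. $\mathcal{F}^{(e)}(P)$ is the set of $f\in\mathbb{Z}^P$ such that (i) $f(v)\in\{1,0,-1\}$ for any $v\in P$, (ii) $\operatorname{supp}(f)$ is an order filter of $P$, and (iii) if $f(v)=-1$, then $v$ is minimal in $\operatorname{supp}(f)$. The enriched order polytope is $\mathcal{O}^{(e)}(P)=\operatorname{conv}\mathcal{F}^{(e)}(P)$, and $m\mathcal{P}=\{mf:f\in\mathcal{P}\}$.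 *)

theory Defs
  imports "HOL-Analysis.Analysis"
begin

text \<open>
  The finite poset \<open>P\<close> is a type \<open>'a\<close> of class \<open>finite\<close> and \<open>order\<close>, and the space of
  real-valued functions on \<open>P\<close> is \<open>real ^ 'a\<close>.
\<close>

definition covered_by :: "'a::order \<Rightarrow> 'a \<Rightarrow> bool" where
  "covered_by w v \<longleftrightarrow> w < v \<and> \<not> (\<exists>u. w < u \<and> u < v)"

definition minimal_in :: "'a::order \<Rightarrow> 'a set \<Rightarrow> bool" where
  "minimal_in v S \<longleftrightarrow> v \<in> S \<and> \<not> (\<exists>w\<in>S. w < v)"

definition order_filter :: "'a::order set \<Rightarrow> bool" where
  "order_filter F \<longleftrightarrow> (\<forall>v w. v \<in> F \<and> v < w \<longrightarrow> w \<in> F)"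

definition left_enriched_partition :: "('a::order \<Rightarrow> int) \<Rightarrow> bool" where
  "left_enriched_partition h \<longleftrightarrow>
     (\<forall>v w. v \<le> w \<longrightarrow> \<bar>h v\<bar> \<le> \<bar>h w\<bar>) \<and>
     (\<forall>v w. v < w \<and> \<bar>h v\<bar> = \<bar>h w\<bar> \<longrightarrow> h w \<ge> 0)"

definition left_enriched_partitions :: "nat \<Rightarrow> ('a::order \<Rightarrow> int) set" where
  "left_enriched_partitions m =
     {h. left_enriched_partition h \<and> (\<forall>v. \<bar>h v\<bar> \<le> int m)}"

definition supp :: "real ^ 'a \<Rightarrow> 'a set" where
  "supp f = {v. f $ v \<noteq> 0}"

definition integer_points :: "(real ^ 'a) set" where
  "integer_points = {f. \<forall>v. f $ v \<in> \<int>}"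

definition enriched_filters :: "(real ^ 'a::{finite,order}) set" where
  "enriched_filters =
     {f \<in> integer_points.
        (\<forall>v. f $ v \<in> {1, 0, -1}) \<and>
        order_filter (supp f) \<and>
        (\<forall>v. f $ v = -1 \<longrightarrow> minimal_in v (supp f))}"

definition enriched_order_polytope :: "(real ^ 'a::{finite,order}) set" where
  "enriched_order_polytope = convex hull enriched_filters"

text \<open>
  If \<open>v\<close> is not minimal, finiteness of \<open>'a\<close> makes the set under \<open>Max\<close> finite and nonempty.
\<close>

definition Theta :: "('a::{finite,order} \<Rightarrow> int) \<Rightarrow> real ^ 'a::{finite,order}" where
  "Theta h = (\<chi> v. of_int
     (if minimal_in v UNIV \<or> h v \<ge> 0 then h v
      else h v + 2 * Max {\<bar>h w\<bar> | w. covered_by w v}))"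

end

theory Submission
  imports Defs
begin

text \<open>
  Let \<open>M v\<close> be the maximum of \<open>\<bar>h w\<bar>\<close> over \<open>w < v\<close> (and \<open>0\<close> if \<open>v\<close> is minimal). Then
  \<open>\<bar>h v\<bar> = M v + \<bar>\<Theta>(h)(v) - M v\<bar>\<close>, and \<open>h v \<ge> 0\<close> holds iff \<open>\<Theta>(h)(v) \<ge> M v\<close>. So \<open>h\<close> is
  recovered from \<open>\<Theta>(h)\<close> by recursion along \<open>P\<close>, and every integer point arises from some left
  enriched \<open>P\<close>-partition. It remains to match the bound \<open>\<bar>h\<bar> \<le> m\<close> with membership in the
  dilated polytope. Slicing \<open>h\<close> at the heights \<open>1, \<dots>, m\<close> writes \<open>\<Theta>(h)\<close> as a sum of \<open>m\<close>
  elements of \<open>\<F>\<^sup>(\<^sup>e\<^sup>)(P)\<close>. Conversely, the polytope lies in the projection to the first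
  coordinate of the convex set of pairs \<open>(f, a)\<close> with \<open>\<bar>f v\<bar> \<le> a v \<le> 1\<close> and
  \<open>2 a w - f v \<le> a v\<close> for \<open>w < v\<close>; and these inequalities, scaled by \<open>m\<close>, force
  \<open>\<bar>h\<bar> \<le> m a \<le> m\<close> by induction along \<open>P\<close>.
\<close>

section \<open>Induction and covers in finite posets\<close>

lemma card_lessThan_less:
  fixes w v :: "'a::{finite,order}"
  assumes "w < v"
  shows "card {..<w} < card {..<v}"
  using assms by (intro psubset_card_mono) auto

lemma finite_order_induct [case_names less]:
  fixes v :: "'a::{finite,order}"
  assumes "\<And>v. (\<And>w. w < v \<Longrightarrow> P w) \<Longrightarrow> P v"
  shows "P v"
proof (induction v rule: measure_induct_rule[where f = "\<lambda>v. card {..<v}"])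
  case (less v)
  then show ?case using assms card_lessThan_less by blast
qed

lemma covered_by_above:
  fixes u v :: "'a::{finite,order}"
  assumes "u < v"
  obtains w where "u \<le> w" "covered_by w v"
proof -
  have "{u..<v} \<noteq> {}" using assms by auto
  then obtain w where w: "w \<in> {u..<v}" "\<forall>x\<in>{u..<v}. w \<le> x \<longrightarrow> w = x"
    using finite_has_maximal[of "{u..<v}"] by auto
  have "\<not> (w < x \<and> x < v)" for x
  proof
    assume x: "w < x \<and> x < v"
    then have "x \<in> {u..<v}" using w(1) by (auto intro: order_trans less_imp_le)
    then show False using w(2) x by (auto dest: less_imp_le)
  qed
  with w(1) that show ?thesis by (auto simp: covered_by_def)
qed

section \<open>The maximum of absolute values below an element\<close>

text \<open>All of \<open>{..<v}\<close> is used instead of the covered elements, which suits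
  induction; the inserted \<open>0\<close> becomes the value at minimal \<open>v\<close>.\<close>

definition lower_max :: "('a::{finite,order} \<Rightarrow> int) \<Rightarrow> 'a \<Rightarrow> int" where
  "lower_max h v = Max (insert 0 ((\<lambda>w. \<bar>h w\<bar>) ` {..<v}))"

lemma lower_max_nonneg: "0 \<le> lower_max h v"
  by (simp add: lower_max_def)

lemma lower_max_upper: "w < v \<Longrightarrow> \<bar>h w\<bar> \<le> lower_max h v"
  by (simp add: lower_max_def)

lemma lower_max_le_iff: "lower_max h v \<le> b \<longleftrightarrow> 0 \<le> b \<and> (\<forall>w<v. \<bar>h w\<bar> \<le> b)"
  by (auto simp: lower_max_def)

lemma lower_max_less_iff: "lower_max h v < b \<longleftrightarrow> 0 < b \<and> (\<forall>w<v. \<bar>h w\<bar> < b)"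
  by (auto simp: lower_max_def)

lemma lower_max_cong: "(\<And>w. w < v \<Longrightarrow> h w = h' w) \<Longrightarrow> lower_max h v = lower_max h' v"
  by (auto simp: lower_max_def intro!: arg_cong[where f = Max])

text \<open>Both conditions become local: \<open>h v\<close> is compared only with values below
  \<open>v\<close>, the form that recursion along the poset needs.\<close>

lemma left_enriched_partition_iff:
  fixes h :: "'a::{finite,order} \<Rightarrow> int"
  shows "left_enriched_partition h \<longleftrightarrow>
    (\<forall>v. lower_max h v \<le> \<bar>h v\<bar> \<and> (h v < 0 \<longrightarrow> lower_max h v < \<bar>h v\<bar>))"
  (is "_ \<longleftrightarrow> ?R")
proof
  assume L: "left_enriched_partition h"
  show ?R
  proof
    fix v
    have "\<bar>h w\<bar> \<le> \<bar>h v\<bar> \<and> (h v < 0 \<longrightarrow> \<bar>h w\<bar> < \<bar>h v\<bar>)" if "w < v" for w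
    proof -
      have "\<bar>h w\<bar> \<le> \<bar>h v\<bar>" "\<bar>h w\<bar> = \<bar>h v\<bar> \<longrightarrow> h v \<ge> 0"
        using L that less_imp_le[OF that] unfolding left_enriched_partition_def by blast+
      then show ?thesis by linarith
    qed
    then show "lower_max h v \<le> \<bar>h v\<bar> \<and> (h v < 0 \<longrightarrow> lower_max h v < \<bar>h v\<bar>)"
      by (auto simp: lower_max_le_iff lower_max_less_iff)
  qed
next
  assume R: ?R
  have "\<bar>h v\<bar> \<le> \<bar>h w\<bar>" "h w < 0 \<longrightarrow> \<bar>h v\<bar> < \<bar>h w\<bar>" if "v < w" for v w
    using lower_max_upper[OF that, of h] R[rule_format, of w] by linarith+
  then show "left_enriched_partition h"
    unfolding left_enriched_partition_def by (metis order_le_less order_less_irrefl not_less)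
qed

lemma lower_max_attained:
  assumes "\<not> minimal_in v UNIV"
  obtains u where "u < v" "lower_max h v = \<bar>h u\<bar>"
proof -
  obtain w where "w < v" using assms by (auto simp: minimal_in_def)
  have "lower_max h v \<in> insert 0 ((\<lambda>w. \<bar>h w\<bar>) ` {..<v})"
    unfolding lower_max_def by (rule Max_in) simp_all
  then consider "lower_max h v = 0" | u where "u < v" "lower_max h v = \<bar>h u\<bar>"
    by blast
  then show thesis
  proof cases
    case 1
    \<comment> \<open>The default \<open>0\<close> is attained too, since
      \<open>\<bar>h w\<bar>\<close> lies between \<open>0\<close> and the maximum.\<close>
    then show thesis using that[OF \<open>w < v\<close>] lower_max_upper[OF \<open>w < v\<close>, of h] by simp
  qed (rule that)
qed

text \<open>Absolute values grow along the order, so a covered element above a maximizer is again a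
  maximizer.\<close>

lemma Max_covered_by_eq:
  fixes h :: "'a::{finite,order} \<Rightarrow> int"
  assumes "left_enriched_partition h" "\<not> minimal_in v UNIV"
  shows "Max {\<bar>h w\<bar> | w. covered_by w v} = lower_max h v"
proof (rule Max_eqI)
  show "finite {\<bar>h w\<bar> | w. covered_by w v}"
    by (rule finite_subset[of _ "range (\<lambda>w. \<bar>h w\<bar>)"]) (blast, simp)
next
  have le: "\<bar>h w\<bar> \<le> lower_max h v" if "covered_by w v" for w
    using that unfolding covered_by_def by (blast intro: lower_max_upper)
  then show "y \<le> lower_max h v" if "y \<in> {\<bar>h w\<bar> | w. covered_by w v}" for y
    using that by blast
  obtain u where u: "u < v" "lower_max h v = \<bar>h u\<bar>"
    using lower_max_attained[OF assms(2)] .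
  obtain w where w: "u \<le> w" "covered_by w v" using covered_by_above[OF u(1)] .
  have "\<bar>h u\<bar> \<le> \<bar>h w\<bar>"
    using assms(1) w(1) unfolding left_enriched_partition_def by blast
  with le[OF w(2)] u(2) have "lower_max h v = \<bar>h w\<bar>" by linarith
  with w(2) show "lower_max h v \<in> {\<bar>h w\<bar> | w. covered_by w v}" by blast
qed

section \<open>The map \<open>Theta\<close> and its inverse\<close>

lemma Theta_nth:
  fixes h :: "'a::{finite,order} \<Rightarrow> int"
  assumes "left_enriched_partition h"
  shows "Theta h $ v = of_int (if h v \<ge> 0 then h v else h v + 2 * lower_max h v)"
proof (cases "minimal_in v UNIV")
  case True
  then have "lower_max h v = 0"
    by (auto simp: minimal_in_def lower_max_def lessThan_def)
  then show ?thesis using True by (simp add: Theta_def)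
next
  case False
  then show ?thesis by (simp add: Theta_def Max_covered_by_eq[OF assms False])
qed

text \<open>By induction both partitions have the same lower maximum \<open>M\<close> at
  \<open>v\<close>. The branch \<open>h v \<ge> 0\<close> yields values at least \<open>M\<close>,
  the other one values below \<open>M\<close>, so the image determines the branch and then
  \<open>h v\<close>.\<close>

lemma inj_on_Theta: "inj_on Theta (Collect left_enriched_partition)"
proof (rule inj_onI, rule ext)
  fix h h' :: "'a \<Rightarrow> int" and v
  assume "h \<in> Collect left_enriched_partition" "h' \<in> Collect left_enriched_partition"
    and eq: "Theta h = Theta h'"
  then have L: "left_enriched_partition h" "left_enriched_partition h'" by auto
  show "h v = h' v"
  proof (induction v rule: finite_order_induct)
    case (less v)
    then have M: "lower_max h v = lower_max h' v" by (rule lower_max_cong)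
    have "(if h v \<ge> 0 then h v else h v + 2 * lower_max h v)
        = (if h' v \<ge> 0 then h' v else h' v + 2 * lower_max h' v)"
      using arg_cong[OF eq, of "\<lambda>f. f $ v"] unfolding Theta_nth[OF L(1)] Theta_nth[OF L(2)]
      by (simp only: of_int_eq_iff)
    then show ?case
      using L[unfolded left_enriched_partition_iff, rule_format, of v] M
      by (smt (verit))
  qed
qed

text \<open>\<open>M\<close> is \<open>lower_max (Theta_inv g) v\<close> written out, so that the
  termination proof sees recursive calls only at elements below \<open>v\<close>.\<close>

function Theta_inv :: "('a::{finite,order} \<Rightarrow> int) \<Rightarrow> 'a \<Rightarrow> int" where
  "Theta_inv g v = (let M = Max (insert 0 ((\<lambda>w. \<bar>Theta_inv g w\<bar>) ` {..<v}))
     in if M \<le> g v then g v else g v - 2 * M)"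
  by auto
termination
  by (relation "Wellfounded.measure (\<lambda>(g, v). card {..<v})") (auto simp: card_lessThan_less)

declare Theta_inv.simps [simp del]

lemma Theta_inv_eq:
  "Theta_inv g v = (if lower_max (Theta_inv g) v \<le> g v then g v
     else g v - 2 * lower_max (Theta_inv g) v)"
  using Theta_inv.simps[of g v] unfolding lower_max_def Let_def .

text \<open>If \<open>g v < M\<close>, then \<open>g v - 2 * M < - M\<close>, which is the strict
  bound required of negative values.\<close>

lemma left_enriched_partition_Theta_inv: "left_enriched_partition (Theta_inv g)"
  unfolding left_enriched_partition_iff
proof
  fix v
  show "lower_max (Theta_inv g) v \<le> \<bar>Theta_inv g v\<bar> \<and>
      (Theta_inv g v < 0 \<longrightarrow> lower_max (Theta_inv g) v < \<bar>Theta_inv g v\<bar>)"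
    using Theta_inv_eq[of g v] lower_max_nonneg[of "Theta_inv g" v] by (auto split: if_splits)
qed

lemma Theta_Theta_inv: "Theta (Theta_inv g) = (\<chi> v. of_int (g v))"
proof (rule vec_eq_iff[THEN iffD2], rule allI)
  fix v
  show "Theta (Theta_inv g) $ v = (\<chi> v. of_int (g v)) $ v"
    unfolding Theta_nth[OF left_enriched_partition_Theta_inv]
    using Theta_inv_eq[of g v] lower_max_nonneg[of "Theta_inv g" v] by auto
qed

section \<open>Slicing a partition into filter functions\<close>

definition layer :: "('a::{finite,order} \<Rightarrow> int) \<Rightarrow> nat \<Rightarrow> real ^ 'a::{finite,order}" where
  "layer h k = (\<chi> v. of_int (if int k \<le> lower_max h v then 1
     else if int k \<le> \<bar>h v\<bar> then sgn (h v) else 0))"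

text \<open>The support is a superlevel set of \<open>\<bar>h\<bar>\<close>, and a value
  \<open>-1\<close> occurs only where no smaller element has reached height
  \<open>k\<close>.\<close>

lemma layer_in_enriched_filters:
  assumes L: "left_enriched_partition h" and k: "1 \<le> k"
  shows "layer h k \<in> enriched_filters"
proof -
  have M: "lower_max h v \<le> \<bar>h v\<bar>" for v
    using L by (simp add: left_enriched_partition_iff)
  have supp: "supp (layer h k) = {v. int k \<le> \<bar>h v\<bar>}"
    \<comment> \<open>Height \<open>k \<ge> 1\<close> ensures \<open>sgn (h v) \<noteq> 0\<close>
      once \<open>int k \<le> \<bar>h v\<bar>\<close>.\<close>
    using k by (auto simp: supp_def layer_def sgn_if intro: order_trans[OF _ M])
  have "order_filter (supp (layer h k))"
    unfolding order_filter_def supp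
    by (auto intro: order_trans[OF _ order_trans[OF lower_max_upper M]])
  moreover have "minimal_in v (supp (layer h k))" if "layer h k $ v = -1" for v
  proof -
    have "\<not> int k \<le> lower_max h v" "v \<in> supp (layer h k)"
      using that by (auto simp: layer_def supp_def split: if_splits)
    then show ?thesis
      unfolding minimal_in_def supp by (auto dest: lower_max_upper[of _ v h])
  qed
  moreover have "layer h k $ v \<in> {1, 0, -1}" "layer h k $ v \<in> \<int>" for v
    by (auto simp: layer_def sgn_if)
  ultimately show ?thesis
    by (simp add: enriched_filters_def integer_points_def)
qed

lemma sum_indicator_le:
  assumes "0 \<le> c" "c \<le> int m"
  shows "(\<Sum>k=1..m. if int k \<le> c then 1 else 0) = c"
proof -
  have "{k \<in> {1..m}. int k \<le> c} = {1..nat c}" using assms by auto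
  then show ?thesis using assms by (simp flip: sum.inter_filter)
qed

lemma Theta_eq_sum_layer:
  assumes L: "left_enriched_partition h" and m: "\<And>v. \<bar>h v\<bar> \<le> int m"
  shows "Theta h = (\<Sum>k=1..m. layer h k)"
proof (rule vec_eq_iff[THEN iffD2], rule allI)
  fix v
  define M where "M = lower_max h v"
  define s where "s = sgn (h v)"
  have M: "0 \<le> M" "M \<le> \<bar>h v\<bar>"
    using L lower_max_nonneg[of h v] by (auto simp: left_enriched_partition_iff M_def)
  have "(\<Sum>k=1..m. if int k \<le> M then 1 else if int k \<le> \<bar>h v\<bar> then s else 0)
      = (\<Sum>k=1..m. (1 - s) * (if int k \<le> M then 1 else 0) + s * (if int k \<le> \<bar>h v\<bar> then 1 else 0))"
    using M by (intro sum.cong) auto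
  also have "\<dots> = (1 - s) * M + s * \<bar>h v\<bar>"
    using M m[of v] by (simp only: sum.distrib flip: sum_distrib_left)
      (simp only: sum_indicator_le abs_ge_zero order_trans[of M])
  \<comment> \<open>If \<open>s = 0\<close>, then \<open>h v = 0\<close> and hence
    \<open>M = 0\<close>, so the term \<open>(1 - s) * M\<close> vanishes.\<close>
  also have "\<dots> = (if h v \<ge> 0 then h v else h v + 2 * M)"
    using M by (auto simp: s_def sgn_if algebra_simps)
  finally show "Theta h $ v = (\<Sum>k=1..m. layer h k) $ v"
    unfolding Theta_nth[OF L] sum_component layer_def vec_lambda_beta
    by (simp only: M_def s_def flip: of_int_sum)
qed

lemma zero_in_enriched_filters: "0 \<in> enriched_filters"
  by (simp add: enriched_filters_def integer_points_def order_filter_def supp_def)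

lemma Theta_in_scaled_polytope:
  assumes L: "left_enriched_partition h" and m: "\<And>v. \<bar>h v\<bar> \<le> int m"
  shows "Theta h \<in> (\<lambda>f. real m *\<^sub>R f) ` enriched_order_polytope"
proof (cases "m = 0")
  \<comment> \<open>The averaging weights \<open>1 / real m\<close> used below need
    \<open>m \<noteq> 0\<close>; here the sum of layers is empty.\<close>
  case True
  then have "Theta h = real m *\<^sub>R 0" using Theta_eq_sum_layer[OF assms] by simp
  then show ?thesis
    unfolding enriched_order_polytope_def
    using hull_inc[OF zero_in_enriched_filters] by (rule image_eqI)
next
  case False
  have "(\<Sum>k\<in>{1..m}. (1 / real m) *\<^sub>R layer h k) \<in> convex hull enriched_filters"
    using False L
    by (intro convex_sum) (auto intro!: hull_inc layer_in_enriched_filters)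
  moreover have "Theta h = real m *\<^sub>R (\<Sum>k\<in>{1..m}. (1 / real m) *\<^sub>R layer h k)"
    using False Theta_eq_sum_layer[OF assms] by (simp add: scaleR_sum_right)
  ultimately show ?thesis
    unfolding enriched_order_polytope_def by blast
qed

section \<open>Bounding heights over the polytope\<close>

text \<open>\<open>real m * a\<close> is to bound \<open>\<bar>h\<bar>\<close>. The last inequality
  reflects the branch \<open>h v < 0\<close>, where \<open>\<bar>h v\<bar>\<close> is twice the
  lower maximum minus \<open>Theta h $ v\<close>; asking it for each \<open>w\<close> instead of the
  maximum keeps it linear in \<open>(f, a)\<close>.\<close>

definition height_witness :: "real ^ 'a::{finite,order} \<Rightarrow> real ^ 'a::{finite,order} \<Rightarrow> bool" where
  "height_witness f a \<longleftrightarrow> (\<forall>v. \<bar>f $ v\<bar> \<le> a $ v \<and> a $ v \<le> 1 \<and>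
     (\<forall>w<v. 2 * a $ w - f $ v \<le> a $ v))"

lemma convex_height_witness: "convex {p. height_witness (fst p) (snd p)}"
proof -
  have eq: "{p. height_witness (fst p) (snd p)} =
      (\<Inter>v. {p. fst p $ v - snd p $ v \<le> 0} \<inter> {p. - (fst p $ v) - snd p $ v \<le> 0} \<inter>
        {p. snd p $ v \<le> 1} \<inter> (\<Inter>w\<in>{..<v}. {p. 2 * snd p $ w - fst p $ v - snd p $ v \<le> 0}))"
    by (force simp: height_witness_def abs_le_iff)
  have half: "convex {p. l p \<le> b}" if "linear l" for l :: "(real ^ 'a::{finite,order}) \<times> (real ^ 'a::{finite,order}) \<Rightarrow> real" and b
    using convex_linear_vimage[OF that, of "{..b}"] by (simp add: vimage_def)
  show ?thesis
    unfolding eq by (intro convex_INT convex_Int half) (auto intro!: linearI simp: algebra_simps)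
qed

lemma height_witness_enriched_filter:
  assumes "f \<in> enriched_filters"
  shows "height_witness f (\<chi> v. if v \<in> supp f then 1 else 0)"
  unfolding height_witness_def
proof (intro allI conjI impI)
  fix v
  have f: "f $ v \<in> {1, 0, -1}" using assms by (simp add: enriched_filters_def)
  show "\<bar>f $ v\<bar> \<le> (\<chi> v. if v \<in> supp f then 1 else 0) $ v"
    using f by (auto simp: supp_def)
  show "(\<chi> v. if v \<in> supp f then 1 else 0) $ v \<le> (1::real)" by simp
  fix w assume "w < v"
  \<comment> \<open>Above an element of the support, \<open>v\<close> is in the support but not
    minimal there, which excludes \<open>0\<close> and \<open>-1\<close>.\<close>
  have "f $ v = 1" if "w \<in> supp f"
  proof -
    have "v \<in> supp f" "\<not> minimal_in v (supp f)"
      using assms that \<open>w < v\<close>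
      by (auto simp: enriched_filters_def order_filter_def minimal_in_def)
    then show ?thesis using f assms by (auto simp: supp_def enriched_filters_def)
  qed
  then show "2 * (\<chi> v. if v \<in> supp f then 1 else 0) $ w - f $ v
      \<le> (\<chi> v. if v \<in> supp f then 1 else 0) $ v"
    using f by (auto simp: supp_def)
qed

lemma enriched_order_polytope_height_witness:
  fixes f :: "real ^ 'a::{finite,order}"
  assumes "f \<in> enriched_order_polytope"
  obtains a where "height_witness f a"
proof -
  let ?H = "fst ` {p :: (real ^ 'a::{finite,order}) \<times> _. height_witness (fst p) (snd p)}"
  have "enriched_order_polytope \<subseteq> ?H"
    unfolding enriched_order_polytope_def
  proof (rule hull_minimal)
    show "enriched_filters \<subseteq> ?H"
    proof
      fix f :: "real ^ 'a::{finite,order}"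
      assume "f \<in> enriched_filters"
      then have "(f, \<chi> v. if v \<in> supp f then 1 else 0) \<in> {p. height_witness (fst p) (snd p)}"
        using height_witness_enriched_filter by simp
      then show "f \<in> ?H" by (rule rev_image_eqI) simp
    qed
    show "convex ?H"
      by (intro convex_linear_image linear_fst convex_height_witness)
  qed
  with assms that show ?thesis by auto
qed

text \<open>In the reflected case some \<open>w < v\<close> attains the maximum, so
  \<open>\<bar>h v\<bar> = 2 * \<bar>h w\<bar> - real m * f $ v\<close>; the induction hypothesis at
  \<open>w\<close> and the witness inequality finish.\<close>

lemma abs_le_height_witness:
  assumes L: "left_enriched_partition h" and a: "height_witness f a"
    and eq: "Theta h = real m *\<^sub>R f"
  shows "\<bar>real_of_int (h v)\<bar> \<le> real m * a $ v"
proof (induction v rule: finite_order_induct)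
  case (less v)
  have hv: "real m * f $ v = of_int (if h v \<ge> 0 then h v else h v + 2 * lower_max h v)"
    using Theta_nth[OF L, of v] eq by simp
  have abs: "real m * \<bar>f $ v\<bar> \<le> real m * a $ v"
    using a by (intro mult_left_mono) (auto simp: height_witness_def)
  show ?case
  proof (cases "h v \<ge> 0 \<or> lower_max h v = 0")
    case True
    then have "\<bar>real_of_int (h v)\<bar> = real m * \<bar>f $ v\<bar>"
      using arg_cong[OF hv, of abs] by (auto simp: abs_mult)
    then show ?thesis using abs by simp
  next
    case False
    have "lower_max h v \<in> insert 0 ((\<lambda>w. \<bar>h w\<bar>) ` {..<v})"
      unfolding lower_max_def by (rule Max_in) auto
    then obtain w where w: "w < v" "lower_max h v = \<bar>h w\<bar>" using False by auto
    have "real m * (2 * a $ w - f $ v) \<le> real m * a $ v"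
      using a w(1) by (intro mult_left_mono) (auto simp: height_witness_def)
    then show ?thesis
      using less[OF w(1)] hv w(2) False by (simp add: algebra_simps)
  qed
qed

theorem proposition2p9:
  fixes m :: nat
  shows "bij_betw (Theta :: ('a::{finite,order} \<Rightarrow> int) \<Rightarrow> real ^ 'a::{finite,order})
           (left_enriched_partitions m)
           ((\<lambda>f. real m *\<^sub>R f) ` enriched_order_polytope \<inter> integer_points)"
proof (rule bij_betw_imageI)
  show "inj_on (Theta :: ('a \<Rightarrow> int) \<Rightarrow> real ^ 'a::{finite,order}) (left_enriched_partitions m)"
    by (rule inj_on_subset[OF inj_on_Theta]) (auto simp: left_enriched_partitions_def)
  show "(Theta :: ('a \<Rightarrow> int) \<Rightarrow> real ^ 'a::{finite,order}) ` left_enriched_partitions m =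
      (\<lambda>f. real m *\<^sub>R f) ` enriched_order_polytope \<inter> integer_points"
  proof (intro subset_antisym subsetI)
    fix g :: "real ^ 'a::{finite,order}" assume "g \<in> Theta ` left_enriched_partitions m"
    then obtain h where h: "g = Theta h" "left_enriched_partition h" "\<And>v. \<bar>h v\<bar> \<le> int m"
      by (auto simp: left_enriched_partitions_def)
    moreover have "Theta h \<in> integer_points" by (simp add: integer_points_def Theta_def)
    ultimately show "g \<in> (\<lambda>f. real m *\<^sub>R f) ` enriched_order_polytope \<inter> integer_points"
      using Theta_in_scaled_polytope by auto
  next
    fix g :: "real ^ 'a::{finite,order}"
    assume "g \<in> (\<lambda>f. real m *\<^sub>R f) ` enriched_order_polytope \<inter> integer_points"
    then obtain f where f: "f \<in> enriched_order_polytope" "g = real m *\<^sub>R f"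
      and int: "g \<in> integer_points" by auto
    \<comment> \<open>As \<open>g\<close> is an integer point, the floor only changes the type of
      its values.\<close>
    define h where "h = Theta_inv (\<lambda>v. \<lfloor>g $ v\<rfloor>)"
    have L: "left_enriched_partition h"
      unfolding h_def by (rule left_enriched_partition_Theta_inv)
    have g: "Theta h = g"
      using int by (simp add: h_def Theta_Theta_inv vec_eq_iff integer_points_def)
    obtain a where a: "height_witness f a"
      using enriched_order_polytope_height_witness[OF f(1)] .
    have "\<bar>h v\<bar> \<le> int m" for v
    proof -
      have "\<bar>real_of_int (h v)\<bar> \<le> real m * a $ v"
        using abs_le_height_witness[OF L a] g f(2) by simp
      also have "\<dots> \<le> real m"
        using a by (simp add: height_witness_def mult_left_le)
      finally show ?thesis by linarith
    qed
    then have "h \<in> left_enriched_partitions m"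
      using L by (simp add: left_enriched_partitions_def)
    then show "g \<in> Theta ` left_enriched_partitions m"
      using g by blast
  qed
qed

end
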